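(* Let $(X,d_X)$ and $(Y,d_Y)$ be $g$-quasi metric spaces of the same index $r$, and let $d_{XY}$ be the product $g$-quasi metric on $X\times Y$. If $(X\times Y,d_{XY})$ is Lebesgue, then $(X,d_X)$ and $(Y,d_Y)$ are Lebesgue. Likewise, if $(X\times Y,d_{XY})$ is strongly Lebesgue, then $(X,d_X)$ and $(Y,d_Y)$ are strongly Lebesgue.
   Context: A $g$-quasi metric of index $r\ge 0$ on a nonempty set $X$ is a mapping $d:X\times X\to\mathbb R$ such that (a) for all $x,y\in X$, $d(x,y)\ge r$, and $d(x,y)=r\iff x=y$; (b) for all $x,y,z\in X$, $d(x,y)\le d(x,z)+d(z,y)$. (Symmetry is not assumed.) The pair $(X,d)$ is then a $g$-quasi metric space of index $r$. For $x\in X$ and $p>0$ let $B_d(x,p)=\{y\in X: d(x,y)<p\}$. The induced generalized topology $\mu(d)$ is the collection of all unions of members of $\{B_d(x,p):x\in X,\ p>0\}\cup\{\emptyset\}$ (it need not be closed under finite intersections). For $g$-quasi metric spaces $(X,d_X)$, $(Y,d_Y)$ of the same index $r$, the product $g$-quasi metric $d_{XY}$ on $X\times Y$ (again of index $r$) is $d_{XY}((x_1,y_1),(x_2,y_2))=\max\{d_X(x_1,x_2),d_Y(y_1,y_2)\}$. A point $c\in X$ is a cluster point of a sequence $(x_n)$ in $(X,d)$ if it is so in $(X,\mu(d))$, i.e. for every $V\in\mu(d)$ with $c\in V$ and every $k\in\mathbb N$ there is $n\ge k$ with $x_n\in V$. A sequence $(x_n)$ in a $g$-quasi metric space $(X,d)$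 of index $r$ is pseudo-Cauchy if for every $\epsilon>r$ and $k\in\mathbb N$ there exist $p,q\in\mathbb N$ with $p\ne q$ and $p,q\ge k$ such that $d(x_p,x_q)<\epsilon$. $(X,d)$ is Lebesgue if every pseudo-Cauchy sequence with (pairwise) distinct terms has a cluster point in $X$; it is strongly Lebesgue if every pseudo-Cauchy sequence has a cluster point in $X$. *)

theory Defs
  imports Complex_Main
begin

text \<open>
  Spaces are carrier sets with a total function; its values off the carrier are irrelevant.
  Symmetry is not assumed, so in \<open>gball\<close> the centre is the first argument of \<open>d\<close>.
\<close>

locale g_quasi_metric_space =
  fixes r :: real and X :: "'a set" and d :: "'a \<Rightarrow> 'a \<Rightarrow> real"
  assumes index_nonneg: "r \<ge> 0"
    and nonempty: "X \<noteq> {}"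
    and index_le: "\<lbrakk>x \<in> X; y \<in> X\<rbrakk> \<Longrightarrow> r \<le> d x y"
    and eq_index_iff: "\<lbrakk>x \<in> X; y \<in> X\<rbrakk> \<Longrightarrow> d x y = r \<longleftrightarrow> x = y"
    and triangle: "\<lbrakk>x \<in> X; y \<in> X; z \<in> X\<rbrakk> \<Longrightarrow> d x y \<le> d x z + d z y"

definition gball :: "'a set \<Rightarrow> ('a \<Rightarrow> 'a \<Rightarrow> real) \<Rightarrow> 'a \<Rightarrow> real \<Rightarrow> 'a set" where
  "gball X d x p = {y \<in> X. d x y < p}"

definition gtopology :: "'a set \<Rightarrow> ('a \<Rightarrow> 'a \<Rightarrow> real) \<Rightarrow> 'a set set" where
  "gtopology X d = {\<Union>\<A> | \<A>. \<A> \<subseteq> {gball X d x p | x p. x \<in> X \<and> p > 0} \<union> {{}}}"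

definition prod_gqm ::
  "('a \<Rightarrow> 'a \<Rightarrow> real) \<Rightarrow> ('b \<Rightarrow> 'b \<Rightarrow> real) \<Rightarrow> 'a \<times> 'b \<Rightarrow> 'a \<times> 'b \<Rightarrow> real" where
  "prod_gqm dX dY u v = max (dX (fst u) (fst v)) (dY (snd u) (snd v))"

definition cluster_point :: "'a set \<Rightarrow> 'a set set \<Rightarrow> (nat \<Rightarrow> 'a) \<Rightarrow> 'a \<Rightarrow> bool" where
  "cluster_point X \<mu> s c \<longleftrightarrow> c \<in> X \<and> (\<forall>V\<in>\<mu>. c \<in> V \<longrightarrow> (\<forall>k. \<exists>n\<ge>k. s n \<in> V))"

definition pseudo_Cauchy :: "real \<Rightarrow> ('a \<Rightarrow> 'a \<Rightarrow> real) \<Rightarrow> (nat \<Rightarrow> 'a) \<Rightarrow> bool" where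
  "pseudo_Cauchy r d s \<longleftrightarrow>
     (\<forall>\<epsilon>>r. \<forall>k. \<exists>p q. p \<noteq> q \<and> p \<ge> k \<and> q \<ge> k \<and> d (s p) (s q) < \<epsilon>)"

definition Lebesgue_gqm :: "real \<Rightarrow> 'a set \<Rightarrow> ('a \<Rightarrow> 'a \<Rightarrow> real) \<Rightarrow> bool" where
  "Lebesgue_gqm r X d \<longleftrightarrow>
     (\<forall>s. range s \<subseteq> X \<and> inj s \<and> pseudo_Cauchy r d s
        \<longrightarrow> (\<exists>c. cluster_point X (gtopology X d) s c))"

definition strongly_Lebesgue_gqm :: "real \<Rightarrow> 'a set \<Rightarrow> ('a \<Rightarrow> 'a \<Rightarrow> real) \<Rightarrow> bool" where
  "strongly_Lebesgue_gqm r X d \<longleftrightarrow>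
     (\<forall>s. range s \<subseteq> X \<and> pseudo_Cauchy r d s
        \<longrightarrow> (\<exists>c. cluster_point X (gtopology X d) s c))"

lemma g_quasi_metric_space_prod:
  assumes "g_quasi_metric_space r X dX" "g_quasi_metric_space r Y dY"
  shows "g_quasi_metric_space r (X \<times> Y) (prod_gqm dX dY)"
proof -
  interpret X: g_quasi_metric_space r X dX by fact
  interpret Y: g_quasi_metric_space r Y dY by fact
  show ?thesis
  proof
    show "0 \<le> r" by (rule X.index_nonneg)
    show "X \<times> Y \<noteq> {}" using X.nonempty Y.nonempty by auto
  next
    fix u v assume uv: "u \<in> X \<times> Y" "v \<in> X \<times> Y"
    have le: "r \<le> dX (fst u) (fst v)" "r \<le> dY (snd u) (snd v)"
      using uv X.index_le Y.index_le by auto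
    then show "r \<le> prod_gqm dX dY u v" by (auto simp: prod_gqm_def)
    have "prod_gqm dX dY u v = r \<longleftrightarrow> dX (fst u) (fst v) = r \<and> dY (snd u) (snd v) = r"
      using le by (auto simp: prod_gqm_def max_def)
    also have "\<dots> \<longleftrightarrow> u = v"
      using uv X.eq_index_iff[of "fst u" "fst v"] Y.eq_index_iff[of "snd u" "snd v"]
      by (simp add: mem_Times_iff prod_eq_iff)
    finally show "prod_gqm dX dY u v = r \<longleftrightarrow> u = v" .
    fix w assume w: "w \<in> X \<times> Y"
    have "dX (fst u) (fst v) \<le> dX (fst u) (fst w) + dX (fst w) (fst v)"
         "dY (snd u) (snd v) \<le> dY (snd u) (snd w) + dY (snd w) (snd v)"
      using uv w X.triangle Y.triangle by auto
    then show "prod_gqm dX dY u v \<le> prod_gqm dX dY u w + prod_gqm dX dY w v"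
      unfolding prod_gqm_def by linarith
  qed
qed

end

theory Submission
  imports Defs
begin

text \<open>
  Each factor is a retract of the product in a sense that respects both Lebesgue properties.
  Fix \<open>b \<in> Y\<close>. Since \<open>dY b b = r\<close> is the least value that a distance can take, the slice map
  \<open>x \<mapsto> (x, b)\<close> preserves distances; it is injective, so it carries a pseudo-Cauchy sequence of
  \<open>X\<close> (with distinct terms) to one of the product. A cluster point there projects to a cluster
  point of the original sequence because the projection is continuous for the generalized
  topologies: if \<open>c\<close> lies in the ball of radius \<open>p\<close> about \<open>x\<close>, then \<open>p > r\<close>, so for every \<open>y\<close> the
  product ball of radius \<open>p\<close> about \<open>(x, y)\<close> contains \<open>(c, y)\<close>, and it projects into the given
  ball. The lemma \<open>Lebesgue_of_retract\<close> is the transfer along such a retraction; the projection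
  lemmas supply its continuity hypothesis.
\<close>

text \<open>
  The topology is used only through this pointwise form. The ball is centred at an arbitrary
  point: without symmetry, and with balls of radius at most \<open>r\<close> empty, a ball need not contain a
  smaller nonempty ball about each of its points.
\<close>

lemma gtopology_iff:
  "V \<in> gtopology X d \<longleftrightarrow>
     (\<forall>c\<in>V. \<exists>x p. x \<in> X \<and> p > 0 \<and> c \<in> gball X d x p \<and> gball X d x p \<subseteq> V)"
    (is "_ \<longleftrightarrow> ?R")
proof
  assume "V \<in> gtopology X d"
  then show ?R unfolding gtopology_def by blast
next
  assume R: ?R
  let ?A = "{gball X d x p | x p. x \<in> X \<and> p > 0 \<and> gball X d x p \<subseteq> V}"
  have "V = \<Union>?A"
  proof (intro subset_antisym subsetI)
    fix c assume "c \<in> V"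
    then obtain x p where "x \<in> X" "p > 0" "c \<in> gball X d x p" "gball X d x p \<subseteq> V"
      using R by meson
    then show "c \<in> \<Union>?A" by (intro UnionI[of "gball X d x p"]) auto
  qed auto
  moreover have "?A \<subseteq> {gball X d x p | x p. x \<in> X \<and> p > 0} \<union> {{}}" by blast
  ultimately show "V \<in> gtopology X d"
    unfolding gtopology_def by (intro CollectI exI[of _ ?A] conjI)
qed

text \<open>
  Sequences are pushed forward along the nonexpansive section \<open>f\<close> and cluster points are pulled
  back along the continuous retraction \<open>g\<close>; that \<open>f\<close> has a left inverse keeps distinct terms
  distinct.
\<close>

lemma Lebesgue_of_retract:
  assumes f: "\<And>x. x \<in> X \<Longrightarrow> f x \<in> Z"
    and g: "\<And>z. z \<in> Z \<Longrightarrow> g z \<in> X"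
    and gf: "\<And>x. x \<in> X \<Longrightarrow> g (f x) = x"
    and nonexpansive: "\<And>x y. \<lbrakk>x \<in> X; y \<in> X\<rbrakk> \<Longrightarrow> e (f x) (f y) \<le> d x y"
    and continuous: "\<And>V. V \<in> gtopology X d \<Longrightarrow> {z \<in> Z. g z \<in> V} \<in> gtopology Z e"
  shows "Lebesgue_gqm r Z e \<Longrightarrow> Lebesgue_gqm r X d"
    and "strongly_Lebesgue_gqm r Z e \<Longrightarrow> strongly_Lebesgue_gqm r X d"
proof -
  have range: "range (f \<circ> s) \<subseteq> Z" if "range s \<subseteq> X" for s :: "nat \<Rightarrow> _"
    using that f by auto
  have inj: "inj (f \<circ> s)" if "range s \<subseteq> X" "inj s" for s :: "nat \<Rightarrow> _"
  proof (rule injI)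
    fix m n assume "(f \<circ> s) m = (f \<circ> s) n"
    then have "g (f (s m)) = g (f (s n))" by simp
    then have "s m = s n" using that(1) gf by (simp add: range_subsetD)
    then show "m = n" using that(2) by (simp add: inj_eq)
  qed
  have pseudo: "pseudo_Cauchy r e (f \<circ> s)"
    if s: "range s \<subseteq> X" "pseudo_Cauchy r d s" for s
    unfolding pseudo_Cauchy_def
  proof (intro allI impI)
    fix \<epsilon> k assume "\<epsilon> > r"
    then obtain p q where "p \<noteq> q" "p \<ge> k" "q \<ge> k" "d (s p) (s q) < \<epsilon>"
      using s(2) unfolding pseudo_Cauchy_def by blast
    moreover have "e (f (s p)) (f (s q)) \<le> d (s p) (s q)"
      using s(1) by (intro nonexpansive) auto
    ultimately show "\<exists>p q. p \<noteq> q \<and> p \<ge> k \<and> q \<ge> k \<and> e ((f \<circ> s) p) ((f \<circ> s) q) < \<epsilon>"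
      by (intro exI[of _ p] exI[of _ q]) simp
  qed
  have cluster: "cluster_point X (gtopology X d) s (g z)"
    if s: "range s \<subseteq> X" and z: "cluster_point Z (gtopology Z e) (f \<circ> s) z" for s z
    unfolding cluster_point_def
  proof (intro conjI ballI impI allI)
    have "z \<in> Z" using z by (simp add: cluster_point_def)
    then show "g z \<in> X" by (rule g)
    fix V k assume V: "V \<in> gtopology X d" "g z \<in> V"
    have "\<forall>k. \<exists>n\<ge>k. (f \<circ> s) n \<in> {z \<in> Z. g z \<in> V}"
    proof (rule mp)
      show "z \<in> {z \<in> Z. g z \<in> V} \<longrightarrow> (\<forall>k. \<exists>n\<ge>k. (f \<circ> s) n \<in> {z \<in> Z. g z \<in> V})"
        using z continuous[OF V(1)] unfolding cluster_point_def by (elim conjE) (rule bspec)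
      show "z \<in> {z \<in> Z. g z \<in> V}" using \<open>z \<in> Z\<close> V(2) by simp
    qed
    then obtain n where "n \<ge> k" and "(f \<circ> s) n \<in> {z \<in> Z. g z \<in> V}" by blast
    then have "g (f (s n)) \<in> V" by simp
    moreover have "g (f (s n)) = s n" using s by (intro gf) auto
    ultimately show "\<exists>n\<ge>k. s n \<in> V" using \<open>n \<ge> k\<close> by auto
  qed
  show "Lebesgue_gqm r X d" if L: "Lebesgue_gqm r Z e"
    unfolding Lebesgue_gqm_def
  proof (intro allI impI; elim conjE)
    fix s assume s: "range s \<subseteq> X" "inj s" "pseudo_Cauchy r d s"
    then obtain z where "cluster_point Z (gtopology Z e) (f \<circ> s) z"
      using L range[OF s(1)] inj[OF s(1,2)] pseudo[OF s(1,3)]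
      unfolding Lebesgue_gqm_def by blast
    then show "\<exists>c. cluster_point X (gtopology X d) s c" using cluster[OF s(1)] by blast
  qed
  show "strongly_Lebesgue_gqm r X d" if L: "strongly_Lebesgue_gqm r Z e"
    unfolding strongly_Lebesgue_gqm_def
  proof (intro allI impI; elim conjE)
    fix s assume s: "range s \<subseteq> X" "pseudo_Cauchy r d s"
    then obtain z where "cluster_point Z (gtopology Z e) (f \<circ> s) z"
      using L range[OF s(1)] pseudo[OF s] unfolding strongly_Lebesgue_gqm_def by blast
    then show "\<exists>c. cluster_point X (gtopology X d) s c" using cluster[OF s(1)] by blast
  qed
qed

text \<open>
  Product balls are rectangles of equal radii. The second factor causes no obstruction at a point
  \<open>(c, y)\<close>: with centre \<open>(x, y)\<close> its side is the ball of radius \<open>p\<close> about \<open>y\<close>, which contains \<open>y\<close>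
  because the spaces share their index: \<open>p > dX x c \<ge> r = dY y y\<close>.
\<close>

lemma gtopology_vimage_fst:
  assumes "g_quasi_metric_space r X dX" "g_quasi_metric_space r Y dY"
    and V: "V \<in> gtopology X dX"
  shows "{z \<in> X \<times> Y. fst z \<in> V} \<in> gtopology (X \<times> Y) (prod_gqm dX dY)"
  unfolding gtopology_iff
proof
  interpret X: g_quasi_metric_space r X dX by fact
  interpret Y: g_quasi_metric_space r Y dY by fact
  fix z assume "z \<in> {z \<in> X \<times> Y. fst z \<in> V}"
  then obtain c y where z: "z = (c, y)" "c \<in> X" "y \<in> Y" "c \<in> V" by auto
  obtain x p where x: "x \<in> X" "p > 0" and c: "c \<in> gball X dX x p" and sub: "gball X dX x p \<subseteq> V"
    using V z unfolding gtopology_iff by blast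
  have "dY y y = r" using Y.eq_index_iff z by simp
  moreover have "r \<le> dX x c" using X.index_le x z by simp
  ultimately have "z \<in> gball (X \<times> Y) (prod_gqm dX dY) (x, y) p"
    using z c by (simp add: gball_def prod_gqm_def)
  moreover have "gball (X \<times> Y) (prod_gqm dX dY) (x, y) p \<subseteq> {z \<in> X \<times> Y. fst z \<in> V}"
    using sub by (auto simp: gball_def prod_gqm_def)
  ultimately show "\<exists>w p. w \<in> X \<times> Y \<and> p > 0 \<and> z \<in> gball (X \<times> Y) (prod_gqm dX dY) w p \<and>
      gball (X \<times> Y) (prod_gqm dX dY) w p \<subseteq> {z \<in> X \<times> Y. fst z \<in> V}"
    using x z by blast
qed

lemma gtopology_vimage_snd:
  assumes "g_quasi_metric_space r X dX" "g_quasi_metric_space r Y dY"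
    and V: "V \<in> gtopology Y dY"
  shows "{z \<in> X \<times> Y. snd z \<in> V} \<in> gtopology (X \<times> Y) (prod_gqm dX dY)"
  unfolding gtopology_iff
proof
  interpret X: g_quasi_metric_space r X dX by fact
  interpret Y: g_quasi_metric_space r Y dY by fact
  fix z assume "z \<in> {z \<in> X \<times> Y. snd z \<in> V}"
  then obtain x c where z: "z = (x, c)" "x \<in> X" "c \<in> Y" "c \<in> V" by auto
  obtain y p where y: "y \<in> Y" "p > 0" and c: "c \<in> gball Y dY y p" and sub: "gball Y dY y p \<subseteq> V"
    using V z unfolding gtopology_iff by blast
  have "dX x x = r" using X.eq_index_iff z by simp
  moreover have "r \<le> dY y c" using Y.index_le y z by simp
  ultimately have "z \<in> gball (X \<times> Y) (prod_gqm dX dY) (x, y) p"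
    using z c by (simp add: gball_def prod_gqm_def)
  moreover have "gball (X \<times> Y) (prod_gqm dX dY) (x, y) p \<subseteq> {z \<in> X \<times> Y. snd z \<in> V}"
    using sub by (auto simp: gball_def prod_gqm_def)
  ultimately show "\<exists>w p. w \<in> X \<times> Y \<and> p > 0 \<and> z \<in> gball (X \<times> Y) (prod_gqm dX dY) w p \<and>
      gball (X \<times> Y) (prod_gqm dX dY) w p \<subseteq> {z \<in> X \<times> Y. snd z \<in> V}"
    using y z by blast
qed

theorem theorem5p12:
  fixes r :: real
    and X :: "'a set" and dX :: "'a \<Rightarrow> 'a \<Rightarrow> real"
    and Y :: "'b set" and dY :: "'b \<Rightarrow> 'b \<Rightarrow> real"
  assumes "g_quasi_metric_space r X dX"
    and "g_quasi_metric_space r Y dY"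
  shows "(Lebesgue_gqm r (X \<times> Y) (prod_gqm dX dY) \<longrightarrow>
            Lebesgue_gqm r X dX \<and> Lebesgue_gqm r Y dY) \<and>
         (strongly_Lebesgue_gqm r (X \<times> Y) (prod_gqm dX dY) \<longrightarrow>
            strongly_Lebesgue_gqm r X dX \<and> strongly_Lebesgue_gqm r Y dY)"
proof -
  interpret X: g_quasi_metric_space r X dX by fact
  interpret Y: g_quasi_metric_space r Y dY by fact
  obtain a b where a: "a \<in> X" and b: "b \<in> Y" using X.nonempty Y.nonempty by blast
  have ra: "dX a a = r" and rb: "dY b b = r"
    using X.eq_index_iff Y.eq_index_iff a b by simp_all
  have slice_X: "prod_gqm dX dY (x, b) (x', b) \<le> dX x x'" if "x \<in> X" "x' \<in> X" for x x'
    using X.index_le[OF that] rb by (simp add: prod_gqm_def)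
  have slice_Y: "prod_gqm dX dY (a, y) (a, y') \<le> dY y y'" if "y \<in> Y" "y' \<in> Y" for y y'
    using Y.index_le[OF that] ra by (simp add: prod_gqm_def)
  note retract_X = Lebesgue_of_retract[where f = "\<lambda>x. (x, b)" and g = fst
      and X = X and d = dX and Z = "X \<times> Y" and e = "prod_gqm dX dY",
      OF _ _ _ slice_X gtopology_vimage_fst[OF assms]]
  note retract_Y = Lebesgue_of_retract[where f = "\<lambda>y. (a, y)" and g = snd
      and X = Y and d = dY and Z = "X \<times> Y" and e = "prod_gqm dX dY",
      OF _ _ _ slice_Y gtopology_vimage_snd[OF assms]]
  show ?thesis
    using a b by (intro conjI impI; intro retract_X retract_Y) auto
qed

end
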